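(* Let $N\ge M\ge 1$, let $\beta$, $a$, $dq_0$ be as in the context, where $dq_0$ satisfies condition (B) and $$\int_{|z|<1}|z|^{\gamma}\,dq_0(z)+\int_{|z|\ge 1}|z|^{\gamma-1}\,dq_0(z)<\infty$$ with $\gamma=2$ in case (I) and $\gamma=1$ in case (II). Let $f_0:\mathbb{R}^N\to\mathbb{R}$ be $\mathbb{Z}^N$-periodic with $|f_0(y)-f_0(y')|\le L|y-y'|^{\theta_2}$ for some $L>0$, $\theta_2\in(0,1]$. For $\lambda>0$ let $v_\lambda$ be the periodic viscosity solution of (I) $\;\lambda v_\lambda(y)-a(y)\int_{\mathbb{R}^M}[v_\lambda(y+\beta(z))-v_\lambda(y)-\langle\nabla v_\lambda(y),\beta(z)\rangle]\,dq_0(z)-f_0(y)=0$ in $\mathbb{T}^N$ (resp. (II) $\;\lambda v_\lambda(y)-a(y)\int_{\mathbb{R}^M}[v_\lambda(y+\beta(z))-v_\lambda(y)]\,dq_0(z)-f_0(y)=0$ in $\mathbb{T}^N$). Then there exists a unique real number $d$ such that $\lim_{\lambda\to 0}\lambda v_\lambda(y)=d$ uniformly on $\mathbb{T}^N$. Moreover $d$ is characterized by the property: for every $\delta>0$ there exist a periodic viscosity subsolution $v_\delta$ of $d-a(y)\int_{\mathbb{R}^M}[v(y+\beta(z))-v(y)-\langle\nabla v(y),\beta(z)\rangle]\,dq_0(z)-f_0(y)\le\delta$ in $\mathbb{T}^N$ and a periodic viscosity supersolution $v^\delta$ of $d-a(y)\int_{\mathbb{R}^M}[v(y+\beta(z))-v(y)-\langle\nabla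 v(y),\beta(z)\rangle]\,dq_0(z)-f_0(y)\ge-\delta$ in $\mathbb{T}^N$ (resp. the same two inequalities with the term $\langle\nabla v(y),\beta(z)\rangle$ removed in case (II)).
   Context: $\mathbb{T}^N=[0,1]^N$; functions on $\mathbb{T}^N$ are $\mathbb{Z}^N$-periodic functions on $\mathbb{R}^N$. $\beta:\mathbb{R}^M\to\mathbb{R}^N$ is continuous with $\beta(cz)=c\beta(z)$ for $c>0$ and $|\beta(z)|\le B_1|z|$. $a$ is continuous, $\mathbb{Z}^N$-periodic, $a\ge a_0>0$, $|a(y)-a(y')|\le L|y-y'|^{\theta_1}$, $\theta_1\in(0,1]$. $dq_0$ is a positive Radon measure on $\mathbb{R}^M$. Condition (B): with $S_0=\mathrm{supp}(dq_0)$, for any $y,y'\in\mathbb{T}^N$ there exist points $y_1=y,\dots,y_m=y'$ in $\mathbb{T}^N$ such that for any $\varepsilon_i>0$ there exist $J_i\subset S_0$ ($1\le i\le m-1$) with $y_i+\beta(z)\in B_{\varepsilon_i}(y_{i+1})$ (mod $\mathbb{Z}^N$) for all $z\in J_i$ and $\int_{J_i}dq_0>0$. Viscosity notions: for an equation or inequality of the form $G(y,u(y))-a(y)\int_{\mathbb{R}^M}[u(y+\beta(z))-u(y)-\langle\nabla u(y),\beta(z)\rangle]\,dq_0(z)\;\{\le c,\ \ge c,\ =c\}$ with $G$ continuous, an upper semicontinuous periodic $u$ is a subsolution (of "$\le c$") if for every $\hat y$ and $\phi\in C^2$ with $u-\phi$ attaining a global maximum at $\hat y$, $u(\hat y)=\phi(\hat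 y)$, the integrand with $\nabla u(\hat y)$ replaced by $\nabla\phi(\hat y)$ is $dq_0$-integrable and the inequality $\le c$ holds at $\hat y$ with this replacement; a lower semicontinuous periodic $u$ is a supersolution (of "$\ge c$") if the same holds with "global minimum" and "$\ge c$"; a solution is a continuous function that is both. In case (II) the gradient term is absent. *)

theory Defs
  imports "HOL-Analysis.Analysis"
begin

definition torus_cube :: "(real^'n) set" where
  "torus_cube = {y. \<forall>i. 0 \<le> y$i \<and> y$i \<le> 1}"

definition zperiodic :: "(real^'n \<Rightarrow> real) \<Rightarrow> bool" where
  "zperiodic u \<longleftrightarrow> (\<forall>y k. (\<forall>i. k$i \<in> \<int>) \<longrightarrow> u (y + k) = u y)"

definition usc :: "(real^'n \<Rightarrow> real) \<Rightarrow> bool" where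
  "usc u \<longleftrightarrow> (\<forall>x. \<forall>e>0. \<forall>\<^sub>F y in at x. u y < u x + e)"

definition lsc :: "(real^'n \<Rightarrow> real) \<Rightarrow> bool" where
  "lsc u \<longleftrightarrow> (\<forall>x. \<forall>e>0. \<forall>\<^sub>F y in at x. u y > u x - e)"

definition C2_grad :: "(real^'n \<Rightarrow> real) \<Rightarrow> (real^'n \<Rightarrow> real^'n) \<Rightarrow> bool" where
  "C2_grad phi Dphi \<longleftrightarrow> (\<exists>H :: real^'n \<Rightarrow> real^'n^'n. continuous_on UNIV H \<and>
     (\<forall>x. (phi has_derivative (\<lambda>h. Dphi x \<bullet> h)) (at x)) \<and>
     (\<forall>x. (Dphi has_derivative (\<lambda>h. H x *v h)) (at x)))"

definition msupport :: "'a::metric_space measure \<Rightarrow> 'a set" where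
  "msupport q = {z. \<forall>e>0. emeasure q (ball z e) > 0}"

definition nl_integrand ::
  "bool \<Rightarrow> (real^'m \<Rightarrow> real^'n) \<Rightarrow> (real^'n \<Rightarrow> real) \<Rightarrow> real^'n \<Rightarrow> real^'n \<Rightarrow> real^'m \<Rightarrow> real" where
  "nl_integrand with_grad \<beta> u p y z =
     u (y + \<beta> z) - u y - (if with_grad then p \<bullet> \<beta> z else 0)"

definition visc_sub ::
  "bool \<Rightarrow> (real^'m) measure \<Rightarrow> (real^'m \<Rightarrow> real^'n) \<Rightarrow> (real^'n \<Rightarrow> real)
   \<Rightarrow> (real^'n \<Rightarrow> real \<Rightarrow> real) \<Rightarrow> real \<Rightarrow> (real^'n \<Rightarrow> real) \<Rightarrow> bool" where
  "visc_sub with_grad q \<beta> a G c u \<longleftrightarrow> usc u \<and> zperiodic u \<and>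
     (\<forall>yh phi Dphi. C2_grad phi Dphi \<and> (\<forall>y. u y - phi y \<le> u yh - phi yh) \<and> u yh = phi yh \<longrightarrow>
        integrable q (nl_integrand with_grad \<beta> u (Dphi yh) yh) \<and>
        G yh (u yh) - a yh * (\<integral>z. nl_integrand with_grad \<beta> u (Dphi yh) yh z \<partial>q) \<le> c)"

definition visc_super ::
  "bool \<Rightarrow> (real^'m) measure \<Rightarrow> (real^'m \<Rightarrow> real^'n) \<Rightarrow> (real^'n \<Rightarrow> real)
   \<Rightarrow> (real^'n \<Rightarrow> real \<Rightarrow> real) \<Rightarrow> real \<Rightarrow> (real^'n \<Rightarrow> real) \<Rightarrow> bool" where
  "visc_super with_grad q \<beta> a G c u \<longleftrightarrow> lsc u \<and> zperiodic u \<and>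
     (\<forall>yh phi Dphi. C2_grad phi Dphi \<and> (\<forall>y. u y - phi y \<ge> u yh - phi yh) \<and> u yh = phi yh \<longrightarrow>
        integrable q (nl_integrand with_grad \<beta> u (Dphi yh) yh) \<and>
        G yh (u yh) - a yh * (\<integral>z. nl_integrand with_grad \<beta> u (Dphi yh) yh z \<partial>q) \<ge> c)"

definition visc_sol ::
  "bool \<Rightarrow> (real^'m) measure \<Rightarrow> (real^'m \<Rightarrow> real^'n) \<Rightarrow> (real^'n \<Rightarrow> real)
   \<Rightarrow> (real^'n \<Rightarrow> real \<Rightarrow> real) \<Rightarrow> real \<Rightarrow> (real^'n \<Rightarrow> real) \<Rightarrow> bool" where
  "visc_sol with_grad q \<beta> a G c u \<longleftrightarrow> continuous_on UNIV u \<and>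
     visc_sub with_grad q \<beta> a G c u \<and> visc_super with_grad q \<beta> a G c u"

definition condB :: "(real^'m) measure \<Rightarrow> (real^'m \<Rightarrow> real^'n) \<Rightarrow> bool" where
  "condB q \<beta> \<longleftrightarrow> (\<forall>y\<in>torus_cube. \<forall>y'\<in>torus_cube. \<exists>ys. ys \<noteq> [] \<and> hd ys = y \<and> last ys = y' \<and>
     set ys \<subseteq> torus_cube \<and>
     (\<forall>i. Suc i < length ys \<longrightarrow> (\<forall>\<epsilon>>0. \<exists>J. J \<in> sets q \<and> J \<subseteq> msupport q \<and> emeasure q J > 0 \<and>
        (\<forall>z\<in>J. \<exists>k::real^'n. (\<forall>j. k$j \<in> \<int>) \<and> dist (ys!i + \<beta> z) (ys!(Suc i) + k) < \<epsilon>))))"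

end

theory Submission
  imports Defs "HOL-Complex_Analysis.Great_Picard"
begin

text \<open>
  After division by \<open>a\<close> the nonlocal operator is translation invariant. Doubling variables with the
  shifted penalty \<open>C |x - y - h|\<^sup>2\<close> therefore compares \<open>v_\<lambda>(\<cdot> + h)\<close> with \<open>v_\<lambda>\<close>, and this bounds
  \<open>\<lambda> v_\<lambda>(y + h) - \<lambda> v_\<lambda>(y)\<close> by the moduli of continuity of \<open>a\<close> and \<open>f_0\<close>, uniformly in \<open>\<lambda>\<close>.
  By Arzela-Ascoli, \<open>\<lambda> v_\<lambda>\<close> has uniform limits along subsequences. Such a limit \<open>W\<close> is a subsolution
  of the homogeneous equation, so its maximum is propagated from \<open>y\<close> to every \<open>y + \<beta>(z)\<close> with \<open>z\<close> in
  the support of \<open>q\<^sub>0\<close>, and condition (B) forces \<open>W\<close> to be constant. Thus the oscillation of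
  \<open>\<lambda> v_\<lambda>\<close> tends to \<open>0\<close>, which makes \<open>v_\<lambda>\<close> an approximate corrector. The same doubling argument
  with \<open>h = 0\<close> compares the constants of approximate sub- and supersolutions, which gives both
  the convergence of \<open>\<lambda> v_\<lambda>\<close> and the uniqueness of \<open>d\<close>.
\<close>

section \<open>Semicontinuous periodic functions\<close>

text \<open>If no point of \<open>K\<close> were maximal, the open sets where
  \<open>F < F y\<close>, for \<open>y\<close> in \<open>K\<close>, would cover \<open>K\<close>. In
  a finite subcover, a point \<open>y\<close> with the largest \<open>F y\<close> lies in none of
  the sets.\<close>

lemma upper_semicontinuous_attains_sup:
  fixes F :: "'a::topological_space \<Rightarrow> real"
  assumes "compact K" "K \<noteq> {}"
    and usc: "\<And>x e. e > 0 \<Longrightarrow> \<forall>\<^sub>F y in nhds x. F y < F x + e"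
  shows "\<exists>x\<in>K. \<forall>y\<in>K. F y \<le> F x"
proof (rule ccontr)
  assume "\<not> ?thesis"
  then have ex: "\<forall>x\<in>K. \<exists>y\<in>K. F x < F y" by (meson not_le)
  have op: "open {x. F x < c}" for c
  proof (subst open_subopen, intro ballI)
    fix x assume "x \<in> {x. F x < c}"
    then have "\<forall>\<^sub>F y in nhds x. F y < c"
      using usc[of "c - F x" x] by simp
    then obtain S where "open S" "x \<in> S" "\<forall>y\<in>S. F y < c" unfolding eventually_nhds by auto
    then show "\<exists>T. open T \<and> x \<in> T \<and> T \<subseteq> {x. F x < c}" by auto
  qed
  have "K \<subseteq> (\<Union>y\<in>K. {x. F x < F y})" using ex by auto
  then obtain Y where Y: "Y \<subseteq> K" "finite Y" "K \<subseteq> (\<Union>y\<in>Y. {x. F x < F y})"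
    using compactE_image[OF assms(1), of K "\<lambda>y. {x. F x < F y}"] op by metis
  have "Y \<noteq> {}" using Y assms(2) by auto
  with Y(2) obtain y0 where y0: "y0 \<in> Y" "\<forall>y\<in>Y. F y \<le> F y0"
    using Max_in[of "F ` Y"] Max_ge[of "F ` Y"] by (metis (no_types, lifting) finite_imageI image_iff image_is_empty)
  from y0(1) Y obtain y where "y \<in> Y" "F y0 < F y" by blast
  with y0 show False by force
qed

lemma usc_nhds:
  assumes "usc u" "e > 0"
  shows "\<forall>\<^sub>F y in nhds x. u y < u x + e"
proof -
  have "\<forall>\<^sub>F y in nhds x. y \<noteq> x \<longrightarrow> u y < u x + e"
    using assms by (simp add: usc_def eventually_at_filter)
  then show ?thesis by eventually_elim (use assms(2) in force)
qed

lemma lsc_uminus: "lsc u \<longleftrightarrow> usc (\<lambda>y. - u y)"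
proof -
  have "(- u y < - u x + e) = (u y > u x - e)" for x y e by auto
  then show ?thesis by (simp only: usc_def lsc_def)
qed

lemma usc_if_continuous:
  assumes "continuous_on UNIV u"
  shows "usc u"
  unfolding usc_def
proof (intro allI impI)
  fix x and e :: real assume "e > 0"
  have "(u \<longlongrightarrow> u x) (at x)" using assms by (simp add: continuous_on_eq_continuous_at isCont_def)
  from order_tendstoD(2)[OF this, of "u x + e"] \<open>e > 0\<close> show "\<forall>\<^sub>F y in at x. u y < u x + e" by simp
qed

lemma zperiodic_uminus: "zperiodic (\<lambda>y. - u y) \<longleftrightarrow> zperiodic u"
  by (simp add: zperiodic_def)

lemma zperiodic_minus:
  assumes "zperiodic u" "\<forall>i. k$i \<in> \<int>"
  shows "u (y - k) = u y"
  using assms unfolding zperiodic_def by (metis diff_add_cancel)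

lemma compact_torus_cube: "compact (torus_cube :: (real^'n) set)"
proof -
  have "torus_cube = cbox (0 :: real^'n) (\<chi> i. 1)"
    by (auto simp: torus_cube_def mem_box_cart)
  then show ?thesis by (metis compact_cbox)
qed

lemma zero_in_torus_cube: "0 \<in> torus_cube"
  by (simp add: torus_cube_def)

lemma torus_cube_representative:
  fixes y :: "real^'n"
  obtains k where "\<forall>i. k$i \<in> \<int>" "y - k \<in> torus_cube"
proof
  show "\<forall>i. (\<chi> i. real_of_int \<lfloor>y$i\<rfloor>)$i \<in> \<int>" by simp
  show "y - (\<chi> i. real_of_int \<lfloor>y$i\<rfloor>) \<in> torus_cube"
    by (auto simp: torus_cube_def) linarith
qed

lemma usc_zperiodic_attains_sup:
  fixes u :: "real^'n \<Rightarrow> real"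
  assumes "usc u" "zperiodic u"
  obtains x where "x \<in> torus_cube" "\<And>y. u y \<le> u x"
proof -
  obtain x where x: "x \<in> torus_cube" "\<forall>y\<in>torus_cube. u y \<le> u x"
    using upper_semicontinuous_attains_sup[OF compact_torus_cube, of u] usc_nhds[OF assms(1)]
      zero_in_torus_cube by blast
  have "u y \<le> u x" for y
  proof -
    obtain k where k: "\<forall>i. k$i \<in> \<int>" "y - k \<in> torus_cube" by (rule torus_cube_representative)
    show ?thesis using x(2) k zperiodic_minus[OF assms(2) k(1), of y] by metis
  qed
  with x(1) that show ?thesis by blast
qed

lemma continuous_zperiodic_bounded:
  fixes u :: "real^'n \<Rightarrow> real"
  assumes "continuous_on UNIV u" "zperiodic u"
  obtains K where "\<And>y. \<bar>u y\<bar> \<le> K"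
proof -
  obtain x where "\<And>y. \<bar>u y\<bar> \<le> \<bar>u x\<bar>"
  proof (rule usc_zperiodic_attains_sup[of "\<lambda>y. \<bar>u y\<bar>"])
    show "usc (\<lambda>y. \<bar>u y\<bar>)" by (intro usc_if_continuous continuous_intros assms(1))
    show "zperiodic (\<lambda>y. \<bar>u y\<bar>)" using assms(2) by (simp add: zperiodic_def)
  qed auto
  with that[of "\<bar>u x\<bar>"] show ?thesis by simp
qed

text \<open>A common integer shift of \<open>x\<close> and \<open>y\<close> leaves the doubled
  function unchanged, so \<open>x\<close> may be taken in the unit cube. The penalty then confines
  the competing \<open>y\<close> to a bounded set.\<close>

lemma doubling_maximum:
  fixes u w :: "real^'n \<Rightarrow> real"
  assumes u: "usc u" "zperiodic u" and w: "lsc w" "zperiodic w" and "C > 0"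
  obtains x y where
    "\<And>x' y'. u x' - w y' - C * (norm (x' - y' - h))\<^sup>2 \<le> u x - w y - C * (norm (x - y - h))\<^sup>2"
proof -
  define F where "F p = u (fst p) - w (snd p) - C * (norm (fst p - snd p - h))\<^sup>2" for p
  obtain xu where xu: "\<And>y. u y \<le> u xu" using usc_zperiodic_attains_sup[OF u] by blast
  obtain yw where yw: "\<And>y. - w y \<le> - w yw"
    using usc_zperiodic_attains_sup[of "\<lambda>y. - w y"] w lsc_uminus zperiodic_uminus by metis
  \<comment> \<open>When \<open>x - y - h\<close> is longer than \<open>R\<close>, the penalty
    outweighs the largest possible value of \<open>u x - w y\<close>, and the pair
    \<open>(0,0)\<close> does better.\<close>
  define R where "R = sqrt ((u xu - w yw - F (0,0)) / C)"
  have far: "F (x,y) < F (0,0)" if "norm (x - y - h) > R" for x y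
  proof -
    have "(u xu - w yw - F (0,0)) / C < (norm (x - y - h))\<^sup>2"
      using that unfolding R_def by (meson not_le real_le_rsqrt)
    then have "u xu - w yw - F (0,0) < C * (norm (x - y - h))\<^sup>2"
      using \<open>C > 0\<close> by (simp add: pos_divide_less_eq mult.commute)
    then show ?thesis using xu[of x] yw[of y] by (simp add: F_def)
  qed
  define D where "D = R + norm h"
  obtain b where b: "\<forall>x\<in>torus_cube. norm (x::real^'n) \<le> b"
    using compact_torus_cube compact_imp_bounded bounded_iff by metis
  define K where "K = (torus_cube :: (real^'n) set) \<times> cball (0::real^'n) (b + \<bar>D\<bar>)"
  have b0: "b \<ge> 0" using b zero_in_torus_cube by force
  have zK: "(0,0) \<in> K" using zero_in_torus_cube b0 by (simp add: K_def)
  have cK: "compact K" unfolding K_def by (intro compact_Times compact_torus_cube compact_cball)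
  have "\<forall>\<^sub>F q in nhds p. F q < F p + e" if "e > 0" for p e
  proof -
    have 1: "\<forall>\<^sub>F q in nhds p. u (fst q) < u (fst p) + e/3"
      by (rule eventually_compose_filterlim[OF usc_nhds[OF u(1)]])
        (use that in \<open>auto intro: tendsto_fst filterlim_ident\<close>)
    have 2: "\<forall>\<^sub>F q in nhds p. - w (snd q) < - w (snd p) + e/3"
      by (rule eventually_compose_filterlim[OF usc_nhds[of "\<lambda>y. - w y"]])
        (use that w lsc_uminus in \<open>auto intro: tendsto_snd filterlim_ident\<close>)
    have "((\<lambda>q. C * (norm (fst q - snd q - h))\<^sup>2) \<longlongrightarrow> C * (norm (fst p - snd p - h))\<^sup>2) (nhds p)"
      by (intro tendsto_intros filterlim_ident)
    from order_tendstoD(1)[OF this, of "C * (norm (fst p - snd p - h))\<^sup>2 - e/3"] that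
    have 3: "\<forall>\<^sub>F q in nhds p. C * (norm (fst p - snd p - h))\<^sup>2 - e/3 < C * (norm (fst q - snd q - h))\<^sup>2"
      by simp
    show ?thesis using 1 2 3 by eventually_elim (simp add: F_def)
  qed
  then obtain p where p: "p \<in> K" "\<forall>q\<in>K. F q \<le> F p"
    using upper_semicontinuous_attains_sup[OF cK, of F] zK by blast
  have "F (x',y') \<le> F p" for x' y'
  proof -
    obtain k where k: "\<forall>i. k$i \<in> \<int>" "x' - k \<in> torus_cube" by (rule torus_cube_representative)
    have eq: "F (x',y') = F (x' - k, y' - k)"
      using zperiodic_minus[OF u(2) k(1)] zperiodic_minus[OF w(2) k(1)] by (simp add: F_def)
    show ?thesis
    proof (cases "norm (x' - y' - h) > R")
      case True
      then show ?thesis using far p(2) zK by force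
    next
      case False
      have "norm (y' - k) \<le> norm (x' - k) + norm (x' - y' - h) + norm h"
        using norm_triangle_ineq4[of "x' - k" "x' - y'"] norm_triangle_ineq[of "x' - y' - h" h] by simp
      also have "\<dots> \<le> b + \<bar>D\<bar>" using False b k(2) unfolding D_def by fastforce
      finally have "(x' - k, y' - k) \<in> K" using k(2) by (simp add: K_def)
      then show ?thesis using p(2) eq by auto
    qed
  qed
  then show ?thesis using that[of "fst p" "snd p"] by (simp add: F_def)
qed

section \<open>Comparison by doubling of variables\<close>

lemma C2_grad_quadratic:
  "C2_grad (\<lambda>x::real^'n. C * (norm (x - c))\<^sup>2 + d) (\<lambda>x. (2 * C) *\<^sub>R (x - c))"
  unfolding C2_grad_def
proof (intro exI conjI allI)
  show "continuous_on UNIV (\<lambda>x::real^'n. (2 * C) *\<^sub>R mat 1 :: real^'n^'n)" by simp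
  fix x :: "real^'n"
  show "((\<lambda>x. C * (norm (x - c))\<^sup>2 + d) has_derivative (\<lambda>h. ((2 * C) *\<^sub>R (x - c)) \<bullet> h)) (at x)"
    unfolding power2_norm_eq_inner
    by (auto intro!: derivative_eq_intros simp: inner_commute algebra_simps)
  show "((\<lambda>x. (2 * C) *\<^sub>R (x - c)) has_derivative (\<lambda>h. ((2 * C) *\<^sub>R mat 1 :: real^'n^'n) *v h)) (at x)"
    unfolding scaleR_matrix_vector_assoc[symmetric] matrix_vector_mul_lid
    by (auto intro!: derivative_eq_intros)
qed

text \<open>The additive constant \<open>?d\<close> makes the paraboloid touch \<open>u\<close> at
  \<open>x\<close>. Taking \<open>C = 0\<close> gives the test at a global maximum, with zero
  gradient.\<close>

lemma visc_sub_quadratic: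
  assumes "visc_sub g q \<beta> a G c u"
    and "\<And>y. u y - C * (norm (y - x0))\<^sup>2 \<le> u x - C * (norm (x - x0))\<^sup>2"
  shows "integrable q (nl_integrand g \<beta> u ((2 * C) *\<^sub>R (x - x0)) x)"
    and "G x (u x) - a x * (\<integral>z. nl_integrand g \<beta> u ((2 * C) *\<^sub>R (x - x0)) x z \<partial>q) \<le> c"
proof -
  let ?d = "u x - C * (norm (x - x0))\<^sup>2"
  have "integrable q (nl_integrand g \<beta> u ((2 * C) *\<^sub>R (x - x0)) x) \<and>
      G x (u x) - a x * (\<integral>z. nl_integrand g \<beta> u ((2 * C) *\<^sub>R (x - x0)) x z \<partial>q) \<le> c"
    using assms(2) C2_grad_quadratic[of C x0 ?d]
    by (intro assms(1)[unfolded visc_sub_def, THEN conjunct2, THEN conjunct2, rule_format,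
          where phi = "\<lambda>x. C * (norm (x - x0))\<^sup>2 + ?d"]) (auto simp: algebra_simps)
  then show "integrable q (nl_integrand g \<beta> u ((2 * C) *\<^sub>R (x - x0)) x)"
    and "G x (u x) - a x * (\<integral>z. nl_integrand g \<beta> u ((2 * C) *\<^sub>R (x - x0)) x z \<partial>q) \<le> c" by auto
qed

text \<open>Doubling uses this with a negative coefficient, where the paraboloid below
  \<open>u\<close> is concave; \<open>C = 0\<close> gives the test at a global minimum.\<close>

lemma visc_super_quadratic:
  assumes "visc_super g q \<beta> a G c u"
    and "\<And>y. u y - C * (norm (y - x0))\<^sup>2 \<ge> u x - C * (norm (x - x0))\<^sup>2"
  shows "integrable q (nl_integrand g \<beta> u ((2 * C) *\<^sub>R (x - x0)) x)"
    and "G x (u x) - a x * (\<integral>z. nl_integrand g \<beta> u ((2 * C) *\<^sub>R (x - x0)) x z \<partial>q) \<ge> c"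
proof -
  let ?d = "u x - C * (norm (x - x0))\<^sup>2"
  have "integrable q (nl_integrand g \<beta> u ((2 * C) *\<^sub>R (x - x0)) x) \<and>
      G x (u x) - a x * (\<integral>z. nl_integrand g \<beta> u ((2 * C) *\<^sub>R (x - x0)) x z \<partial>q) \<ge> c"
    using assms(2) C2_grad_quadratic[of C x0 ?d]
    by (intro assms(1)[unfolded visc_super_def, THEN conjunct2, THEN conjunct2, rule_format,
          where phi = "\<lambda>x. C * (norm (x - x0))\<^sup>2 + ?d"]) (auto simp: algebra_simps)
  then show "integrable q (nl_integrand g \<beta> u ((2 * C) *\<^sub>R (x - x0)) x)"
    and "G x (u x) - a x * (\<integral>z. nl_integrand g \<beta> u ((2 * C) *\<^sub>R (x - x0)) x z \<partial>q) \<ge> c" by auto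
qed

text \<open>Moving both points of a doubled maximum by the same jump \<open>\<beta> z\<close> leaves
  the penalty unchanged. Hence, once both inequalities are divided by \<open>a\<close>, the nonlocal
  terms compare and drop out, which leaves the zeroth order terms at two points whose difference is
  close to \<open>h\<close>. The integrals contain \<open>u\<close> and \<open>w\<close> themselves,
  so no cut-off near \<open>z = 0\<close> occurs.\<close>

lemma visc_comparison_at_doubled_maximum:
  fixes u w :: "real^'n \<Rightarrow> real"
  assumes u: "visc_sub g q \<beta> a G1 c1 u" and w: "visc_super g q \<beta> a G2 c2 w"
    and a: "\<And>y. a y > 0" and "r > 0"
  obtains x y where "norm (x - y - h) < r" "\<And>t. u (t + h) - w t \<le> u x - w y"
    "(G1 x (u x) - c1) / a x \<le> (G2 y (w y) - c2) / a y"
proof -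
  have up: "usc u" "zperiodic u" using u by (auto simp: visc_sub_def)
  have wp: "lsc w" "zperiodic w" using w by (auto simp: visc_super_def)
  obtain xu where xu: "\<And>y. u y \<le> u xu" using usc_zperiodic_attains_sup[OF up] by blast
  obtain yw where yw: "\<And>y. - w y \<le> - w yw"
    using usc_zperiodic_attains_sup[of "\<lambda>y. - w y"] wp lsc_uminus zperiodic_uminus by metis
  \<comment> \<open>Comparison with the pair \<open>(h, 0)\<close>, where the penalty vanishes,
    bounds the penalty at the maximum by \<open>D\<close>. The summand 1 in \<open>C\<close> makes
    the resulting distance strictly less than \<open>r\<close>.\<close>
  define D where "D = u xu - w yw - (u h - w 0)"
  have D: "D \<ge> 0" using xu[of h] yw[of 0] by (simp add: D_def)
  define C where "C = (D + 1) / r\<^sup>2"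
  have C: "C > 0" "C * r\<^sup>2 = D + 1" using D \<open>r > 0\<close> by (auto simp: C_def)
  obtain x y where max:
    "\<And>x' y'. u x' - w y' - C * (norm (x' - y' - h))\<^sup>2 \<le> u x - w y - C * (norm (x - y - h))\<^sup>2"
    using doubling_maximum[OF up wp C(1), of h] by blast
  have diag: "u (t + h) - w t \<le> u x - w y - C * (norm (x - y - h))\<^sup>2" for t
    using max[of "t + h" t] by simp
  show ?thesis
  proof
    have "C * (norm (x - y - h))\<^sup>2 \<le> D"
      using diag[of 0] xu[of x] yw[of y] by (simp add: D_def)
    then have "C * (norm (x - y - h))\<^sup>2 < C * r\<^sup>2" using C(2) by simp
    then have "(norm (x - y - h))\<^sup>2 < r\<^sup>2" using C(1) by simp
    then show "norm (x - y - h) < r" using \<open>r > 0\<close> by (simp add: power2_less_imp_less)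
    show "u (t + h) - w t \<le> u x - w y" for t
      using diag[of t] C(1) by (smt (verit) mult_nonneg_nonneg zero_le_power2)
    let ?p = "(2 * C) *\<^sub>R (x - y - h)"
    have "u x' - C * (norm (x' - (y + h)))\<^sup>2 \<le> u x - C * (norm (x - (y + h)))\<^sup>2" for x'
      using max[of x' y] by (simp add: diff_diff_eq)
    from visc_sub_quadratic[OF u this]
    have 1: "integrable q (nl_integrand g \<beta> u ?p x)"
      "G1 x (u x) - a x * (\<integral>z. nl_integrand g \<beta> u ?p x z \<partial>q) \<le> c1"
      by (auto simp: diff_diff_eq)
    have flip: "norm (y' - (x - h)) = norm (x - y' - h)" for y'
      using norm_minus_commute[of "x - h" y'] by (simp add: algebra_simps)
    \<comment> \<open>With \<open>x\<close> frozen, \<open>w\<close> is touched from below by a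
      concave paraboloid centred at \<open>x - h\<close>.\<close>
    have "w y' - (- C) * (norm (y' - (x - h)))\<^sup>2 \<ge> w y - (- C) * (norm (y - (x - h)))\<^sup>2" for y'
      unfolding flip using max[of x y'] by simp
    from visc_super_quadratic[OF w this]
    have "integrable q (nl_integrand g \<beta> w ((2 * - C) *\<^sub>R (y - (x - h))) y)"
      "G2 y (w y) - a y * (\<integral>z. nl_integrand g \<beta> w ((2 * - C) *\<^sub>R (y - (x - h))) y z \<partial>q) \<ge> c2"
      by auto
    moreover have "(2 * - C) *\<^sub>R (y - (x - h)) = ?p" by (simp add: algebra_simps)
    ultimately have 2: "integrable q (nl_integrand g \<beta> w ?p y)"
      "G2 y (w y) - a y * (\<integral>z. nl_integrand g \<beta> w ?p y z \<partial>q) \<ge> c2" by auto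
    \<comment> \<open>The two test functions have the same gradient, so the integrands are ordered pointwise.\<close>
    have "nl_integrand g \<beta> u ?p x z \<le> nl_integrand g \<beta> w ?p y z" for z
      using max[of "x + \<beta> z" "y + \<beta> z"] by (simp add: nl_integrand_def)
    then have le: "(\<integral>z. nl_integrand g \<beta> u ?p x z \<partial>q) \<le> (\<integral>z. nl_integrand g \<beta> w ?p y z \<partial>q)"
      by (intro integral_mono 1 2)
    have "(G1 x (u x) - c1) / a x \<le> (\<integral>z. nl_integrand g \<beta> u ?p x z \<partial>q)"
      using 1(2) a[of x] by (simp add: pos_divide_le_eq mult.commute)
    also note le
    also have "(\<integral>z. nl_integrand g \<beta> w ?p y z \<partial>q) \<le> (G2 y (w y) - c2) / a y"
      using 2(2) a[of y] by (simp add: pos_le_divide_eq mult.commute)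
    finally show "(G1 x (u x) - c1) / a x \<le> (G2 y (w y) - c2) / a y" .
  qed
qed

section \<open>Estimates for the zeroth order terms\<close>

text \<open>Multiplication by \<open>a y\<close> leaves errors governed by the moduli of continuity
  of \<open>a\<close> and \<open>f\<close>. Since \<open>r\<close> depends on \<open>A\<close> only
  through the bound \<open>K\<close>, the estimates below are uniform in the discount.\<close>

lemma quotient_comparison:
  fixes a f :: "'b::metric_space \<Rightarrow> real"
  assumes "uniformly_continuous_on UNIV a" "uniformly_continuous_on UNIV f"
    and a: "a0 > 0" "\<And>y. a y \<ge> a0" and f: "\<And>y. \<bar>f y\<bar> \<le> F" and "\<eta> > 0"
  obtains r where "r > 0"
    "\<And>x y A B. \<bar>A\<bar> \<le> K \<Longrightarrow> dist x y < r \<Longrightarrow> (A - f x) / a x \<le> (B - f y) / a y \<Longrightarrow> A \<le> B + \<eta>"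
proof -
  define c where "c = (\<bar>K\<bar> + \<bar>F\<bar> + 1) / a0"
  have c: "c > 0" using a(1) by (simp add: c_def)
  obtain r1 where r1: "r1 > 0" "\<And>x y. dist x y < r1 \<Longrightarrow> \<bar>a x - a y\<bar> < \<eta> / (2 * c)"
    using assms(1) c \<open>\<eta> > 0\<close> unfolding uniformly_continuous_on_def dist_real_def
    by (metis UNIV_I divide_pos_pos mult_pos_pos zero_less_numeral)
  obtain r2 where r2: "r2 > 0" "\<And>x y. dist x y < r2 \<Longrightarrow> \<bar>f x - f y\<bar> < \<eta> / 2"
    using assms(2) \<open>\<eta> > 0\<close> unfolding uniformly_continuous_on_def dist_real_def
    by (metis UNIV_I half_gt_zero)
  show ?thesis
  proof
    show "min r1 r2 > 0" using r1 r2 by simp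
    fix x y A B
    assume A: "\<bar>A\<bar> \<le> K" and d: "dist x y < min r1 r2" and le: "(A - f x) / a x \<le> (B - f y) / a y"
    have ax: "a x > 0" "a y > 0" using a by (metis less_le_trans)+
    have "(A - f x) / a x * a y \<le> B - f y" using le ax(2) by (simp add: pos_le_divide_eq)
    moreover have "(A - f x) / a x * a y = A - f x - (A - f x) / a x * (a x - a y)"
      using ax(1) by (simp add: field_simps)
    moreover have "(A - f x) / a x * (a x - a y) \<le> \<eta> / 2"
    proof -
      have "\<bar>A - f x\<bar> \<le> \<bar>K\<bar> + \<bar>F\<bar> + 1" using A f[of x] by linarith
      then have "\<bar>(A - f x) / a x\<bar> \<le> c"
        unfolding c_def abs_divide using ax a by (intro frac_le) auto
      moreover have "\<bar>a x - a y\<bar> \<le> \<eta> / (2 * c)" using r1(2)[of x y] d by simp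
      ultimately have "\<bar>(A - f x) / a x\<bar> * \<bar>a x - a y\<bar> \<le> c * (\<eta> / (2 * c))"
        using c by (intro mult_mono) auto
      also have "\<dots> = \<eta> / 2" using c by simp
      finally show ?thesis by (metis abs_le_D1 abs_mult)
    qed
    moreover have "f x - f y \<le> \<eta> / 2" using r2(2)[of x y] d by linarith
    ultimately show "A \<le> B + \<eta>" by linarith
  qed
qed

lemma hoelder_imp_uniformly_continuous:
  fixes f :: "'b::metric_space \<Rightarrow> real"
  assumes "\<theta> > 0" "\<And>x y. \<bar>f x - f y\<bar> \<le> L * dist x y powr \<theta>"
  shows "uniformly_continuous_on UNIV f"
  unfolding uniformly_continuous_on_def
proof (intro allI impI)
  fix e :: real assume "e > 0"
  \<comment> \<open>A positive constant in place of \<open>L\<close>, so that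
    \<open>L' * d powr \<theta> = e\<close> can be solved for \<open>d\<close>.\<close>
  define L' where "L' = \<bar>L\<bar> + 1"
  define d where "d = (e / L') powr (1 / \<theta>)"
  have L': "L' > 0" by (simp add: L'_def)
  have d: "d > 0" using \<open>e > 0\<close> L' by (simp add: d_def)
  have "dist (f x') (f x) < e" if "dist x' x < d" for x x'
  proof -
    have "dist x' x powr \<theta> < d powr \<theta>"
      using that assms(1) by (intro powr_less_mono2) auto
    also have "\<dots> = e / L'" using assms(1) \<open>e > 0\<close> L' by (simp add: d_def powr_powr)
    finally have *: "L' * dist x' x powr \<theta> < e" using L' by (simp add: pos_less_divide_eq mult.commute)
    have "L * dist x' x powr \<theta> \<le> L' * dist x' x powr \<theta>"
      unfolding L'_def by (intro mult_right_mono) auto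
    then show ?thesis using assms(2)[of x' x] * by (simp add: dist_real_def)
  qed
  then show "\<exists>d>0. \<forall>x\<in>UNIV. \<forall>x'\<in>UNIV. dist x' x < d \<longrightarrow> dist (f x') (f x) < e"
    using d by blast
qed

section \<open>Bounds and equicontinuity uniform in the discount\<close>

text \<open>At a global maximum of \<open>v\<close> a constant is an admissible test function, and
  the integrand, then free of a gradient term, is nonpositive.\<close>

lemma discounted_upper_bound:
  assumes sub: "visc_sub g q \<beta> a (\<lambda>y r. lam * r - f y) 0 v" and "lam > 0"
    and a: "\<And>y. a y > 0" and f: "\<And>y. \<bar>f y\<bar> \<le> F"
  shows "lam * v y \<le> F"
proof -
  have "usc v" "zperiodic v" using sub by (auto simp: visc_sub_def)
  then obtain x where x: "\<And>y. v y \<le> v x" using usc_zperiodic_attains_sup by blast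
  have int: "integrable q (nl_integrand g \<beta> v 0 x)"
    and le: "lam * v x - f x - a x * (\<integral>z. nl_integrand g \<beta> v 0 x z \<partial>q) \<le> 0"
    using visc_sub_quadratic[OF sub, of 0 x x] x by auto
  have "(\<integral>z. nl_integrand g \<beta> v 0 x z \<partial>q) \<le> (\<integral>z. 0 \<partial>q)"
    by (intro integral_mono int) (auto simp: nl_integrand_def x)
  then have "a x * (\<integral>z. nl_integrand g \<beta> v 0 x z \<partial>q) \<le> 0"
    using a[of x] by (simp add: mult_le_0_iff)
  then have "lam * v x \<le> F" using le f[of x] by linarith
  then show ?thesis using mult_left_mono[OF x[of y], of lam] \<open>lam > 0\<close> by linarith
qed

lemma discounted_lower_bound:
  assumes super: "visc_super g q \<beta> a (\<lambda>y r. lam * r - f y) 0 v" and "lam > 0"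
    and a: "\<And>y. a y > 0" and f: "\<And>y. \<bar>f y\<bar> \<le> F"
  shows "- F \<le> lam * v y"
proof -
  have "lsc v" "zperiodic v" using super by (auto simp: visc_super_def)
  then obtain x where x: "\<And>y. v x \<le> v y"
    using usc_zperiodic_attains_sup[of "\<lambda>y. - v y"] lsc_uminus zperiodic_uminus
    by (metis neg_le_iff_le)
  have le: "lam * v x - f x - a x * (\<integral>z. nl_integrand g \<beta> v 0 x z \<partial>q) \<ge> 0"
    using visc_super_quadratic[OF super, of x 0 x] x by auto
  have "0 \<le> (\<integral>z. nl_integrand g \<beta> v 0 x z \<partial>q)"
    by (intro Bochner_Integration.integral_nonneg) (auto simp: nl_integrand_def x)
  then have "a x * (\<integral>z. nl_integrand g \<beta> v 0 x z \<partial>q) \<ge> 0"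
    using a[of x] by simp
  then have "- F \<le> lam * v x" using le f[of x] by linarith
  then show ?thesis using mult_left_mono[OF x[of y], of lam] \<open>lam > 0\<close> by linarith
qed

lemma discounted_bound:
  assumes "visc_sol g q \<beta> a (\<lambda>y r. lam * r - f y) 0 v" and "lam > 0"
    and "\<And>y. a y > 0" and "\<And>y. \<bar>f y\<bar> \<le> F"
  shows "\<bar>lam * v y\<bar> \<le> F"
  using discounted_upper_bound[of g q \<beta> a lam f v F y] discounted_lower_bound[of g q \<beta> a lam f v F y] assms
  by (simp add: visc_sol_def abs_le_iff minus_le_iff)

text \<open>Doubling is applied to \<open>v\<close> against itself with \<open>h = s - t\<close>.
  The increment of \<open>v\<close> over \<open>h\<close> is at most \<open>v x - v y\<close> at the
  doubled maximum, where \<open>x\<close> and \<open>y\<close> are within \<open>r\<close>: one half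
  of \<open>r\<close> pays for \<open>h\<close>, the other for the doubling error. The bound
  \<open>F\<close> on \<open>lam * v\<close> makes \<open>r\<close> independent of
  \<open>lam\<close>.\<close>

lemma discounted_equicontinuous:
  fixes a f :: "real^'n \<Rightarrow> real"
  assumes "uniformly_continuous_on UNIV a" "uniformly_continuous_on UNIV f"
    and a: "a0 > 0" "\<And>y. a y \<ge> a0" and f: "\<And>y. \<bar>f y\<bar> \<le> F" and "\<eta> > 0"
  obtains r where "r > 0"
    "\<And>lam v s t. lam > 0 \<Longrightarrow> visc_sol g q \<beta> a (\<lambda>y r. lam * r - f y) 0 v \<Longrightarrow>
      dist s t < r \<Longrightarrow> \<bar>lam * v s - lam * v t\<bar> \<le> \<eta>"
proof -
  obtain r where r: "r > 0"
    "\<And>x y A B. \<bar>A\<bar> \<le> F \<Longrightarrow> dist x y < r \<Longrightarrow> (A - f x) / a x \<le> (B - f y) / a y \<Longrightarrow> A \<le> B + \<eta>"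
    using quotient_comparison[OF assms(1,2) a f \<open>\<eta> > 0\<close>, of F] by blast
  have apos: "\<And>y. a y > 0" using a by (metis less_le_trans)
  have *: "lam * v s - lam * v t \<le> \<eta>"
    if lam: "lam > 0" and v: "visc_sol g q \<beta> a (\<lambda>y r. lam * r - f y) 0 v" and st: "dist s t < r / 2"
    for lam v s t
  proof -
    have vs: "visc_sub g q \<beta> a (\<lambda>y r. lam * r - f y) 0 v" "visc_super g q \<beta> a (\<lambda>y r. lam * r - f y) 0 v"
      using v by (auto simp: visc_sol_def)
    obtain x y where xy: "norm (x - y - (s - t)) < r / 2"
      "\<And>t'. v (t' + (s - t)) - v t' \<le> v x - v y"
      "(lam * v x - f x - 0) / a x \<le> (lam * v y - f y - 0) / a y"
      using visc_comparison_at_doubled_maximum[OF vs apos, of "r/2" "s - t"] r(1) by (metis half_gt_zero)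
    have "dist x y < r"
      using norm_triangle_ineq[of "x - y - (s - t)" "s - t"] xy(1) st by (simp add: dist_norm)
    then have "lam * v x \<le> lam * v y + \<eta>"
      using r(2)[of "lam * v x" x y "lam * v y"] xy(3) discounted_bound[OF v lam apos f] by simp
    moreover have "lam * (v s - v t) \<le> lam * (v x - v y)"
      using xy(2)[of t] lam by (intro mult_left_mono) auto
    ultimately show ?thesis by (simp add: algebra_simps)
  qed
  show ?thesis
  proof
    show "r / 2 > 0" using r by simp
    show "\<bar>lam * v s - lam * v t\<bar> \<le> \<eta>" if "lam > 0" "visc_sol g q \<beta> a (\<lambda>y r. lam * r - f y) 0 v"
      "dist s t < r / 2" for lam v s t
      using *[OF that(1,2), of s t] *[OF that(1,2), of t s] that(3) by (simp add: dist_commute abs_le_iff)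
  qed
qed

text \<open>In the ergodic inequalities the zeroth order terms do not involve the unknown function,
  so doubling with \<open>h = 0\<close> compares the constants directly, with
  \<open>A = d1 - \<delta>1\<close> and \<open>B = d2 + \<delta>2\<close>.\<close>

lemma ergodic_constant_comparison:
  fixes a f :: "real^'n \<Rightarrow> real"
  assumes "uniformly_continuous_on UNIV a" "uniformly_continuous_on UNIV f"
    and a: "a0 > 0" "\<And>y. a y \<ge> a0" and f: "\<And>y. \<bar>f y\<bar> \<le> F"
    and u: "visc_sub g q \<beta> a (\<lambda>y r. d1 - f y) \<delta>1 u"
    and w: "visc_super g q \<beta> a (\<lambda>y r. d2 - f y) (- \<delta>2) w"
  shows "d1 \<le> d2 + \<delta>1 + \<delta>2"
proof (rule field_le_epsilon)
  fix \<eta> :: real assume "\<eta> > 0"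
  obtain r where r: "r > 0"
    "\<And>x y A B. \<bar>A\<bar> \<le> \<bar>d1 - \<delta>1\<bar> \<Longrightarrow> dist x y < r \<Longrightarrow> (A - f x) / a x \<le> (B - f y) / a y \<Longrightarrow> A \<le> B + \<eta>"
    using quotient_comparison[OF assms(1,2) a f \<open>\<eta> > 0\<close>, of "\<bar>d1 - \<delta>1\<bar>"] by blast
  have apos: "\<And>y. a y > 0" using a by (metis less_le_trans)
  obtain x y where "norm (x - y - 0) < r" "(d1 - f x - \<delta>1) / a x \<le> (d2 - f y - - \<delta>2) / a y"
    using visc_comparison_at_doubled_maximum[OF u w apos r(1), of 0] by metis
  then show "d1 \<le> d2 + \<delta>1 + \<delta>2 + \<eta>"
    using r(2)[of "d1 - \<delta>1" x y "d2 + \<delta>2"] by (simp add: dist_norm algebra_simps)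
qed

section \<open>The strong maximum principle\<close>

text \<open>The exponent is \<gamma> inside the unit ball and \<gamma> - 1 outside, with \<gamma> =
  2 if \<open>g\<close> holds and \<gamma> = 1 otherwise. Its integral is the sum of the two moments
  in the hypothesis.\<close>

definition levy_weight :: "bool \<Rightarrow> 'a::real_normed_vector \<Rightarrow> real" where
  "levy_weight g z = (if norm z < 1 then norm z ^ (if g then 2 else 1) else norm z ^ (if g then 1 else 0))"

lemma levy_weight_nonneg: "levy_weight g z \<ge> 0"
  by (simp add: levy_weight_def)

lemma integrable_levy_weight:
  fixes q :: "'a::euclidean_space measure"
  assumes q: "sets q = sets borel"
    and "(\<integral>\<^sup>+ z. ennreal (indicator {z. norm z < 1} z * norm z ^ (if g then 2 else 1)) \<partial>q)
        + (\<integral>\<^sup>+ z. ennreal (indicator {z. norm z \<ge> 1} z * norm z ^ (if g then 1 else 0)) \<partial>q) < \<infinity>"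
      (is "?I1 + ?I2 < _")
  shows "integrable q (levy_weight g)"
proof (rule integrableI_nonneg)
  have q': "measurable q borel = measurable borel (borel :: real measure)"
    "measurable q borel = measurable borel (borel :: ennreal measure)"
    by (intro measurable_cong_sets q refl)+
  show "levy_weight g \<in> borel_measurable q"
    unfolding levy_weight_def q' by measurable
  have "(\<integral>\<^sup>+ z. ennreal (levy_weight g z) \<partial>q)
    = (\<integral>\<^sup>+ z. ennreal (indicator {z. norm z < 1} z * norm z ^ (if g then 2 else 1))
        + ennreal (indicator {z. norm z \<ge> 1} z * norm z ^ (if g then 1 else 0)) \<partial>q)"
    by (intro nn_integral_cong) (auto simp: levy_weight_def split: split_indicator)
  also have "\<dots> = ?I1 + ?I2"
    by (intro nn_integral_add; unfold q'; measurable)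
  finally show "(\<integral>\<^sup>+ z. ennreal (levy_weight g z) \<partial>q) < \<infinity>" using assms(2) by simp
qed (simp add: levy_weight_nonneg)

lemma small_multiple_eventually:
  fixes c K :: real
  assumes "c > 0"
  shows "\<forall>\<^sub>F s in at_right 0. s * K < c"
proof -
  have "((\<lambda>s. s * K) \<longlongrightarrow> 0 * K) (at_right 0)" by (intro tendsto_intros)
  from order_tendstoD(2)[OF this, of c] assms show ?thesis by simp
qed

text \<open>Beyond distance \<open>sqrt (2 * F / s)\<close> from \<open>c\<close> the penalty
  exceeds \<open>2 * F\<close>, the largest possible gain over \<open>v c\<close>, so a compact ball
  suffices.\<close>

lemma penalised_maximum_exists:
  fixes v :: "'a::euclidean_space \<Rightarrow> real"
  assumes "continuous_on UNIV v" "\<And>y. \<bar>v y\<bar> \<le> F" "s > 0"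
  obtains x where "\<And>y. v y - s * (norm (y - c))\<^sup>2 \<le> v x - s * (norm (x - c))\<^sup>2"
proof -
  define R where "R = sqrt (2 * F / s)"
  have F: "F \<ge> 0" using assms(2)[of 0] by linarith
  have "continuous_on (cball c R) (\<lambda>y. v y - s * (norm (y - c))\<^sup>2)"
    by (intro continuous_intros continuous_on_subset[OF assms(1)]) auto
  moreover have "c \<in> cball c R" using F assms(3) by (simp add: R_def)
  ultimately obtain x where x: "x \<in> cball c R"
    "\<forall>y\<in>cball c R. v y - s * (norm (y - c))\<^sup>2 \<le> v x - s * (norm (x - c))\<^sup>2"
    using continuous_attains_sup[OF compact_cball, of c R] by blast
  have "v y - s * (norm (y - c))\<^sup>2 \<le> v x - s * (norm (x - c))\<^sup>2" for y
  proof (cases "y \<in> cball c R")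
    case False
    then have "sqrt (2 * F / s) < norm (y - c)" by (simp add: R_def dist_norm norm_minus_commute)
    then have "2 * F / s < (norm (y - c))\<^sup>2" by (meson not_le real_le_rsqrt)
    then have "2 * F < s * (norm (y - c))\<^sup>2" using assms(3) by (simp add: pos_divide_less_eq mult.commute)
    then have "v y - s * (norm (y - c))\<^sup>2 \<le> v c" using assms(2)[of y] assms(2)[of c] by linarith
    also have "\<dots> \<le> v x - s * (norm (x - c))\<^sup>2" using x(2) \<open>c \<in> cball c R\<close> by fastforce
    finally show ?thesis .
  qed (use x in auto)
  with that show ?thesis by blast
qed

text \<open>Multiplied by \<open>lam k\<close>, the subsolution inequality bounds the integrated
  increments of \<open>lam k * v k\<close> below by a quantity tending to 0. If \<open>W\<close>
  dropped after the jump \<open>\<beta> z0\<close>, the drop would persist for \<open>z\<close> near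
  \<open>z0\<close>, a set of positive measure because \<open>z0\<close> is in the support. Other
  jumps from an almost maximal point gain almost nothing, so the integral would stay
  negative.\<close>

lemma limit_maximum_propagates:
  fixes v :: "nat \<Rightarrow> real^'n \<Rightarrow> real" and \<beta> :: "real^'m \<Rightarrow> real^'n"
  assumes sub: "\<And>k. visc_sub g q \<beta> a (\<lambda>y r. lam k * r - f y) 0 (v k)"
    and cont: "\<And>k. continuous_on UNIV (v k)"
    and lam: "\<And>k. lam k > 0" "lam \<longlonglongrightarrow> 0"
    and bd: "\<And>k y. \<bar>lam k * v k y\<bar> \<le> F" and f: "\<And>y. \<bar>f y\<bar> \<le> F"
    and a: "a0 > 0" "\<And>y. a y \<ge> a0"
    and \<beta>: "continuous_on UNIV \<beta>" "\<And>z. norm (\<beta> z) \<le> B * norm z" "B \<ge> 0"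
    and q: "sets q = sets borel" "\<And>K. compact K \<Longrightarrow> emeasure q K < \<infinity>"
    and weight: "integrable q (levy_weight g)"
    and conv: "\<And>e. e > 0 \<Longrightarrow> \<forall>\<^sub>F k in sequentially. \<forall>y. \<bar>lam k * v k y - W y\<bar> < e"
    and W: "continuous_on UNIV W" "\<And>y. W y \<le> W yh"
    and z0: "z0 \<in> msupport q"
  shows "W (yh + \<beta> z0) = W yh"
proof (rule ccontr)
  assume "\<not> ?thesis"
  with W(2)[of "yh + \<beta> z0"] have gap: "W (yh + \<beta> z0) < W yh" by simp
  \<comment> \<open>A quarter of the drop: one quarter pays for the variation of \<open>W\<close>
    near the jump, one for the approximation error and the gradient term, and
    \<open>2 * \<kappa>\<close> remains on \<open>J\<close>.\<close>
  define \<kappa> where "\<kappa> = (W yh - W (yh + \<beta> z0)) / 4"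
  have \<kappa>: "\<kappa> > 0" "W (yh + \<beta> z0) = W yh - 4 * \<kappa>" using gap by (auto simp: \<kappa>_def field_simps)
  have "continuous_on UNIV (\<lambda>p. W (fst p + \<beta> (snd p)))"
    by (intro continuous_on_compose2[OF W(1)] continuous_intros continuous_on_compose2[OF \<beta>(1)]) auto
  then have "isCont (\<lambda>p. W (fst p + \<beta> (snd p))) (yh, z0)"
    by (simp add: continuous_on_eq_continuous_at)
  then obtain \<rho>0 where \<rho>0: "\<rho>0 > 0"
    "\<And>p. dist p (yh, z0) < \<rho>0 \<Longrightarrow> dist (W (fst p + \<beta> (snd p))) (W (yh + \<beta> z0)) < \<kappa>"
    unfolding continuous_at_eps_delta using \<kappa>(1) by (metis fst_conv snd_conv)
  \<comment> \<open>Half of \<open>\<rho>0\<close> for each of the two variables; the cap 1 keeps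
    \<open>norm z\<close> below \<open>norm z0 + 1\<close> on \<open>J\<close>.\<close>
  define \<rho> where "\<rho> = min 1 (\<rho>0 / 2)"
  have \<rho>: "\<rho> > 0" "\<rho> \<le> 1" using \<rho>0 by (auto simp: \<rho>_def)
  have near: "W (y + \<beta> z) \<le> W yh - 3 * \<kappa>" if "norm (y - yh) < \<rho>" "z \<in> ball z0 \<rho>" for y z
  proof -
    have "dist (y, z) (yh, z0) \<le> dist y yh + dist z z0"
      unfolding dist_Pair_Pair by (intro sqrt_sum_squares_le_sum) auto
    also have "\<dots> < \<rho>0" using that by (auto simp: \<rho>_def dist_norm norm_minus_commute)
    finally have "dist (W (y + \<beta> z)) (W (yh + \<beta> z0)) < \<kappa>" using \<rho>0(2)[of "(y, z)"] by simp
    then show ?thesis using \<kappa>(2) by (simp add: dist_real_def)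
  qed
  define J where "J = ball z0 \<rho>"
  have J: "J \<in> sets q" "emeasure q J > 0" using z0 \<rho>(1) q(1) by (auto simp: J_def msupport_def)
  have "emeasure q J \<le> emeasure q (cball z0 \<rho>)"
    using q(1) by (intro emeasure_mono) (auto simp: J_def)
  also have "\<dots> < \<infinity>" by (intro q(2)) simp
  finally have Jfin: "emeasure q J < \<infinity>" .
  define m where "m = measure q J"
  have m: "m > 0" using J(2) Jfin unfolding m_def by (simp add: emeasure_eq_ennreal_measure)
  \<comment> \<open>One constant for all cases of \<open>upper\<close>: \<open>B\<^sup>2\<close>
    comes from the quadratic penalty, \<open>B\<close> from the linear term, and 2 amply covers the
    approximation error at large jumps.\<close>
  define C where "C = B\<^sup>2 + B + 2"
  define I where "I = (\<integral>z. levy_weight g z \<partial>q)"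
  \<comment> \<open>If \<open>w = \<lambda> v_\<lambda>\<close> is within \<open>e = s\<^sup>2\<close> of \<open>W\<close>, a maximum point \<open>x\<close> of \<open>w - s |\<cdot> - yh|\<^sup>2\<close> satisfies
    \<open>|x - yh|\<^sup>2 \<le> 2 s\<close>. So \<open>x\<close> tends to \<open>yh\<close> and the integrand at \<open>x\<close> is at most \<open>s C\<close> times the
    integrable weight, while it stays below \<open>-2 \<kappa>\<close> on a ball around \<open>z0\<close> of positive measure.\<close>
  have "\<forall>\<^sub>F s in at_right 0. s > 0 \<and> s * 8 < 1 \<and> s * 2 < \<rho>\<^sup>2
      \<and> s * (1 + B * (norm z0 + 1)) < \<kappa> \<and> s * (C * I) < \<kappa> * m / 2"
    using \<kappa>(1) m \<rho>(1) by (intro eventually_conj small_multiple_eventually eventually_at_right_less) auto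
  \<comment> \<open>In order, the bounds after positivity give
    \<open>norm (x - yh) \<le> 1 / 2\<close> and \<open>4 * e < s\<close>, place \<open>x\<close>
    within \<open>\<rho>\<close> of \<open>yh\<close>, make the gradient term small on
    \<open>J\<close>, and limit the integral of the majorant to half of
    \<open>\<kappa> * m\<close>.\<close>
  then obtain s where s: "s > 0" "s * 8 < 1" "s * 2 < \<rho>\<^sup>2"
      "s * (1 + B * (norm z0 + 1)) < \<kappa>" "s * (C * I) < \<kappa> * m / 2"
    using eventually_happens[of _ "at_right (0::real)"] by (auto simp: trivial_limit_at_right_real)
  define e where "e = s\<^sup>2"
  have e: "e > 0" "4 * e < s"
    using s by (auto simp: e_def power2_eq_square)
  have "(\<lambda>k. lam k * (2 * F / a0)) \<longlonglongrightarrow> 0 * (2 * F / a0)" by (intro tendsto_intros lam)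
  then have "\<forall>\<^sub>F k in sequentially. lam k * (2 * F / a0) < \<kappa> * m / 2"
    using \<kappa>(1) m by (intro order_tendstoD(2)[where y = 0]) auto
  then obtain k where k: "\<forall>y. \<bar>lam k * v k y - W y\<bar> < e" "lam k * (2 * F / a0) < \<kappa> * m / 2"
    using eventually_happens[OF eventually_conj[OF conv[OF e(1)]]] by auto
  define w where "w y = lam k * v k y" for y
  have wW: "w y < W y + e" "W y < w y + e" for y using k(1)[rule_format, of y] by (auto simp: w_def)
  have "continuous_on UNIV w" unfolding w_def by (intro continuous_intros cont)
  then obtain x where max: "\<And>y. w y - s * (norm (y - yh))\<^sup>2 \<le> w x - s * (norm (x - yh))\<^sup>2"
    using penalised_maximum_exists[of w F s yh] bd s(1) unfolding w_def by metis
  have wx: "w yh + s * (norm (x - yh))\<^sup>2 \<le> w x" using max[of yh] by simp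
  have wx0: "w yh \<le> w x" using wx mult_nonneg_nonneg[OF less_imp_le[OF s(1)] zero_le_power2[of "norm (x - yh)"]] by linarith
  have "s * (norm (x - yh))\<^sup>2 \<le> s * (2 * s)"
    using wx wW(1)[of x] wW(2)[of yh] W(2)[of x] by (simp add: e_def power2_eq_square)
  then have n2: "(norm (x - yh))\<^sup>2 \<le> 2 * s" using s(1) by simp
  have n\<rho>: "norm (x - yh) < \<rho>"
    using n2 s(3) \<rho>(1) by - (rule power2_less_imp_less, auto)
  have n1: "norm (x - yh) \<le> 1 / 2"
    using n2 s(2) by - (rule power2_le_imp_le, simp_all add: power_divide)
  define P where "P = (2 * s) *\<^sub>R (x - yh)"
  have P: "\<bar>P \<bullet> \<beta> z\<bar> \<le> s * (B * norm z)" for z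
  proof -
    have "\<bar>P \<bullet> \<beta> z\<bar> \<le> norm P * norm (\<beta> z)" by (rule Cauchy_Schwarz_ineq2)
    also have "\<dots> \<le> s * (B * norm z)"
    proof (intro mult_mono \<beta>(2))
      show "norm P \<le> s" using mult_left_mono[OF n1, of "2 * s"] s(1) by (simp add: P_def)
    qed (use s(1) in auto)
    finally show ?thesis .
  qed
  \<comment> \<open>The penalty of \<open>w\<close> divided by \<open>lam k\<close> tests
    \<open>v k\<close>. Its gradient \<open>p\<close> satisfies \<open>P = lam k * p\<close>, and
    \<open>N\<close> is the integrand scaled back to \<open>w\<close>.\<close>
  define p where "p = (2 * (s / lam k)) *\<^sub>R (x - yh)"
  define N where "N z = lam k * nl_integrand g \<beta> (v k) p x z" for z
  have N_eq: "N z = w (x + \<beta> z) - w x - (if g then P \<bullet> \<beta> z else 0)" for z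
    using lam(1)[of k] by (auto simp: N_def w_def P_def p_def nl_integrand_def algebra_simps)
  have "v k y - (s / lam k) * (norm (y - yh))\<^sup>2 \<le> v k x - (s / lam k) * (norm (x - yh))\<^sup>2" for y
  proof -
    have "lam k * (v k y - (s / lam k) * (norm (y - yh))\<^sup>2) \<le> lam k * (v k x - (s / lam k) * (norm (x - yh))\<^sup>2)"
      using max[of y] lam(1)[of k] by (simp add: w_def algebra_simps)
    then show ?thesis using lam(1)[of k] by simp
  qed
  from visc_sub_quadratic[OF sub this, folded p_def]
  have int: "integrable q (nl_integrand g \<beta> (v k) p x)"
    and ineq: "lam k * v k x - f x - a x * (\<integral>z. nl_integrand g \<beta> (v k) p x z \<partial>q) \<le> 0" by auto
  have intN: "integrable q N" unfolding N_def using int by simp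
  have lower: "- (lam k * (2 * F / a0)) \<le> (\<integral>z. N z \<partial>q)"
  proof -
    have ax: "a x > 0" using a by (metis less_le_trans)
    have "- (2 * F) \<le> lam k * v k x - f x" using bd[of k x] f[of x] by linarith
    also have "\<dots> \<le> a x * (\<integral>z. nl_integrand g \<beta> (v k) p x z \<partial>q)" using ineq by simp
    finally have "- (2 * F) / a x \<le> (\<integral>z. nl_integrand g \<beta> (v k) p x z \<partial>q)"
      using ax by (simp add: field_simps)
    moreover have "2 * F / a x \<le> 2 * F / a0"
      using a f[of x] by (intro divide_left_mono) (auto intro: mult_pos_pos ax)
    ultimately have "- (2 * F / a0) \<le> (\<integral>z. nl_integrand g \<beta> (v k) p x z \<partial>q)" by simp
    then have "lam k * (- (2 * F / a0)) \<le> lam k * (\<integral>z. nl_integrand g \<beta> (v k) p x z \<partial>q)"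
      using lam(1)[of k] by (intro mult_left_mono) auto
    then show ?thesis by (simp add: N_def)
  qed
  \<comment> \<open>Two bounds on the increment: \<open>b1\<close>, uniform in \<open>z\<close>,
    comes from the maximality of \<open>yh\<close> for \<open>W\<close> and serves large jumps;
    \<open>b2\<close>, small with \<open>\<beta> z\<close>, comes from the maximality of
    \<open>x\<close> and serves small ones.\<close>
  have b1: "w (x + \<beta> z) - w x \<le> 2 * e" for z
    using wW(1)[of "x + \<beta> z"] W(2)[of "x + \<beta> z"] wW(2)[of yh] wx0 by linarith
  have b2: "w (x + \<beta> z) - w x \<le> s * (norm (\<beta> z))\<^sup>2 + P \<bullet> \<beta> z" for z
  proof -
    have square: "(norm (x + \<beta> z - yh))\<^sup>2 = (norm (x - yh))\<^sup>2 + (norm (\<beta> z))\<^sup>2 + 2 * ((x - yh) \<bullet> \<beta> z)"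
      unfolding power2_norm_eq_inner by (simp add: inner_commute algebra_simps)
    show ?thesis using max[of "x + \<beta> z"] unfolding square by (simp add: P_def algebra_simps)
  qed
  have \<beta>2: "s * (norm (\<beta> z))\<^sup>2 \<le> s * (B\<^sup>2 * (norm z)\<^sup>2)" for z
    using \<beta>(2)[of z] s(1) by (intro mult_left_mono) (auto simp: power_mult_distrib[symmetric] power_mono)
  \<comment> \<open>For small jumps the gradient term cancels the linear part of \<open>b2\<close>
    when \<open>g\<close> holds, leaving order two; otherwise order one remains. This matches the
    two exponents of the weight.\<close>
  have upper: "N z \<le> s * C * levy_weight g z" for z
  proof (cases "norm z < 1")
    case small: True
    show ?thesis
    proof (cases g)
      case True
      have "N z \<le> s * (norm (\<beta> z))\<^sup>2" using b2[of z] True by (simp add: N_eq)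
      also have "\<dots> \<le> s * (B\<^sup>2 * (norm z)\<^sup>2)" by (rule \<beta>2)
      also have "\<dots> \<le> s * (C * (norm z)\<^sup>2)"
        using s(1) \<beta>(3) by (intro mult_left_mono mult_right_mono) (auto simp: C_def)
      finally show ?thesis using small True by (simp add: levy_weight_def mult.assoc)
    next
      case False
      have "N z \<le> s * (norm (\<beta> z))\<^sup>2 + P \<bullet> \<beta> z" using b2[of z] False by (simp add: N_eq)
      also have "\<dots> \<le> s * (B\<^sup>2 * (norm z)\<^sup>2) + s * (B * norm z)"
        using \<beta>2[of z] P[of z] by linarith
      also have "\<dots> \<le> s * (B\<^sup>2 * norm z) + s * (B * norm z)"
        using s(1) small by (intro add_right_mono mult_left_mono) (auto simp: power2_eq_square mult_left_le)
      also have "\<dots> \<le> s * C * norm z"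
        using s(1) by (simp add: C_def algebra_simps)
      finally show ?thesis using small False by (simp add: levy_weight_def)
    qed
  next
    case large: False
    show ?thesis
    proof (cases g)
      case True
      have "N z \<le> 2 * e + s * (B * norm z)" using b1[of z] P[of z] True by (simp add: N_eq)
      also have "\<dots> \<le> s * norm z + s * (B * norm z)"
      proof -
        have "s * 1 \<le> s * norm z" using large s(1) by (intro mult_left_mono) auto
        then show ?thesis using e by linarith
      qed
      also have "\<dots> \<le> s * C * norm z"
        using s(1) \<beta>(3) by (simp add: C_def algebra_simps)
      finally show ?thesis using large True by (simp add: levy_weight_def)
    next
      case False
      have "N z \<le> s * 1" using b1[of z] e False by (simp add: N_eq)
      also have "\<dots> \<le> s * C" using s(1) \<beta>(3) by (intro mult_left_mono) (auto simp: C_def)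
      finally show ?thesis using large False by (simp add: levy_weight_def)
    qed
  qed
  have on_J: "N z \<le> - (2 * \<kappa>)" if "z \<in> J" for z
  proof -
    have "norm z \<le> norm z0 + 1"
      using that \<rho>(2) norm_triangle_ineq2[of z z0] by (simp add: J_def dist_norm norm_minus_commute)
    then have "s * (B * norm z) \<le> s * (B * (norm z0 + 1))"
      using s(1) \<beta>(3) by (intro mult_left_mono) auto
    then have "\<bar>P \<bullet> \<beta> z\<bar> + s \<le> \<kappa>" using P[of z] s(4) by (simp add: algebra_simps)
    moreover have "w (x + \<beta> z) \<le> W yh - 3 * \<kappa> + e"
      using near[OF n\<rho>, of z] that wW(1)[of "x + \<beta> z"] by (simp add: J_def)
    moreover have "W yh \<le> w x + e" using wW(2)[of yh] wx0 by linarith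
    ultimately show ?thesis using e by (auto simp: N_eq)
  qed
  \<comment> \<open>The majorant minus \<open>N\<close> is nonnegative everywhere and at least
    \<open>2 * \<kappa>\<close> on \<open>J\<close>, yet its integral is below
    \<open>\<kappa> * m\<close>.\<close>
  have "2 * \<kappa> * m = (\<integral>z. 2 * \<kappa> * indicator J z \<partial>q)"
    using J Jfin by (simp add: m_def)
  also have "\<dots> \<le> (\<integral>z. s * C * levy_weight g z - N z \<partial>q)"
  proof (rule integral_mono)
    show "integrable q (\<lambda>z. 2 * \<kappa> * indicator J z)" using J(1) Jfin by simp
    show "integrable q (\<lambda>z. s * C * levy_weight g z - N z)" using weight intN by simp
    fix z :: "real^'m"
    have "0 \<le> s * C * levy_weight g z"
      using s(1) \<beta>(3) levy_weight_nonneg[of g z] by (simp add: C_def)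
    then show "2 * \<kappa> * indicator J z \<le> s * C * levy_weight g z - N z"
      using upper[of z] on_J[of z] by (auto split: split_indicator)
  qed
  also have "\<dots> = s * (C * I) - (\<integral>z. N z \<partial>q)"
    using weight intN by (simp add: I_def)
  also have "\<dots> < \<kappa> * m" using s(5) lower k(2) by linarith
  finally show False using \<kappa>(1) m by simp
qed

section \<open>Constancy of limits and compactness\<close>

text \<open>Along a chain of condition (B) starting at a maximum point, every point is again a
  maximum point: an admissible jump from one lands, modulo integers, arbitrarily close to the next,
  and \<open>W\<close> is continuous.\<close>

lemma condB_propagation_imp_constant:
  fixes W :: "real^'n \<Rightarrow> real" and \<beta> :: "real^'m \<Rightarrow> real^'n"
  assumes B: "condB q \<beta>" and W: "continuous_on UNIV W" "zperiodic W"
    and spread: "\<And>yh z. (\<And>y. W y \<le> W yh) \<Longrightarrow> z \<in> msupport q \<Longrightarrow> W (yh + \<beta> z) = W yh"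
  shows "W y = W y'"
proof -
  obtain x where x: "x \<in> torus_cube" "\<And>y. W y \<le> W x"
    using usc_zperiodic_attains_sup[OF usc_if_continuous[OF W(1)] W(2)] by blast
  have cube: "W y = W x" if y: "y \<in> torus_cube" for y
  proof -
    obtain ys where ys: "ys \<noteq> []" "hd ys = x" "last ys = y"
      and chain: "\<And>i \<epsilon>. Suc i < length ys \<Longrightarrow> \<epsilon> > 0 \<Longrightarrow> \<exists>J. J \<in> sets q \<and> J \<subseteq> msupport q \<and> emeasure q J > 0 \<and>
        (\<forall>z\<in>J. \<exists>k::real^'n. (\<forall>j. k$j \<in> \<int>) \<and> dist (ys!i + \<beta> z) (ys!(Suc i) + k) < \<epsilon>)"
      using B x(1) y unfolding condB_def by metis
    have "W (ys ! i) = W x" if "i < length ys" for i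
      using that
    proof (induction i)
      case 0
      then show ?case using ys by (simp add: hd_conv_nth)
    next
      case (Suc i)
      then have i: "W (ys ! i) = W x" by simp
      have "\<bar>W (ys ! Suc i) - W x\<bar> < e" if "e > 0" for e
      proof -
        have "isCont W (ys ! Suc i)" using W(1) by (simp add: continuous_on_eq_continuous_at)
        then obtain \<delta> where \<delta>: "\<delta> > 0" "\<And>t. dist t (ys ! Suc i) < \<delta> \<Longrightarrow> dist (W t) (W (ys ! Suc i)) < e"
          unfolding continuous_at_eps_delta using \<open>e > 0\<close> by metis
        obtain J where J: "J \<subseteq> msupport q" "emeasure q J > 0"
          "\<forall>z\<in>J. \<exists>k::real^'n. (\<forall>j. k$j \<in> \<int>) \<and> dist (ys!i + \<beta> z) (ys!(Suc i) + k) < \<delta>"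
          using chain[OF Suc.prems \<delta>(1)] by blast
        then have "J \<noteq> {}" by auto
        then obtain z k where z: "z \<in> msupport q" "\<forall>j. k$j \<in> \<int>" "dist (ys!i + \<beta> z) (ys!(Suc i) + k) < \<delta>"
          using J by blast
        have "dist (ys!i + \<beta> z - k) (ys!(Suc i)) < \<delta>" using z(3) by (simp add: dist_norm algebra_simps)
        then have "dist (W (ys!i + \<beta> z - k)) (W (ys ! Suc i)) < e" by (rule \<delta>(2))
        moreover have "W (ys!i + \<beta> z - k) = W x"
          using zperiodic_minus[OF W(2) z(2)] spread[OF _ z(1), of "ys ! i"] x(2) i by simp
        ultimately show ?thesis by (simp add: dist_real_def abs_minus_commute)
      qed
      then have "\<bar>W (ys ! Suc i) - W x\<bar> \<le> 0" by (meson not_le order_less_irrefl)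
      then show ?case by simp
    qed
    then show ?thesis using ys by (metis last_conv_nth diff_less length_greater_0_conv zero_less_one)
  qed
  have "W y = W x" for y
    using torus_cube_representative[of y] cube zperiodic_minus[OF W(2)] by metis
  then show ?thesis by metis
qed

lemma equicontinuous_zperiodic_subsequence:
  fixes w :: "nat \<Rightarrow> real^'n \<Rightarrow> real"
  assumes per: "\<And>k. zperiodic (w k)" and bd: "\<And>k y. \<bar>w k y\<bar> \<le> F"
    and equi: "\<And>e. e > 0 \<Longrightarrow> \<exists>r>0. \<forall>k s t. dist s t < r \<longrightarrow> \<bar>w k s - w k t\<bar> < e"
  obtains W \<sigma> where "strict_mono \<sigma>" "continuous_on UNIV W" "zperiodic W"
    "\<And>e. e > 0 \<Longrightarrow> \<forall>\<^sub>F k in sequentially. \<forall>y. \<bar>w (\<sigma> k) y - W y\<bar> < e"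
proof -
  obtain g \<sigma> where \<sigma>: "strict_mono (\<sigma> :: nat \<Rightarrow> nat)"
    and g: "\<And>e. e > 0 \<Longrightarrow> \<exists>N. \<forall>n x. n \<ge> N \<and> x \<in> torus_cube \<longrightarrow> norm (w (\<sigma> n) x - g x) < e"
  proof (rule Arzela_Ascoli[OF compact_torus_cube, of w F])
    show "norm (w n x) \<le> F" for n x using bd by simp
    show "\<exists>d>0. \<forall>n y. y \<in> torus_cube \<and> norm (x - y) < d \<longrightarrow> norm (w n x - w n y) < e" if "e > 0" for x e
      using equi[OF that] by (auto simp: dist_norm)
  qed blast
  \<comment> \<open>The limit \<open>g\<close> is controlled only on the cube. The pointwise limit
    agrees with it there and inherits periodicity.\<close>
  define W where "W y = lim (\<lambda>k. w (\<sigma> k) y)" for y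
  have rep: "\<exists>c\<in>torus_cube. (\<forall>k. w k y = w k c) \<and> W y = W c" for y
  proof -
    obtain k where k: "\<forall>i. k$i \<in> \<int>" "y - k \<in> torus_cube" by (rule torus_cube_representative)
    show ?thesis by (rule bexI[OF _ k(2)]) (simp add: W_def zperiodic_minus[OF per k(1)])
  qed
  have Wg: "W c = g c" if "c \<in> torus_cube" for c
    unfolding W_def by (rule limI) (unfold LIMSEQ_iff, use g that in blast)
  have conv: "\<forall>\<^sub>F k in sequentially. \<forall>y. \<bar>w (\<sigma> k) y - W y\<bar> < e" if "e > 0" for e
    unfolding eventually_sequentially using g[OF that] rep Wg by (metis real_norm_def)
  show ?thesis
  proof
    show "strict_mono \<sigma>" by fact
    show "zperiodic W" using per unfolding zperiodic_def W_def by simp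
    have "uniform_limit UNIV (\<lambda>k. w (\<sigma> k)) W sequentially"
      using conv by (auto simp: uniform_limit_iff dist_real_def)
    moreover have "continuous_on UNIV (w k)" for k
      unfolding continuous_on_iff dist_real_def using equi by metis
    ultimately show "continuous_on UNIV W"
      by (intro uniform_limit_theorem[where f = "\<lambda>k. w (\<sigma> k)" and F = sequentially]) auto
  qed (rule conv)
qed

section \<open>The vanishing discount limit\<close>

text \<open>Otherwise some sequence of discounts tending to 0 keeps oscillation at least
  \<open>\<eta>\<close>. A uniform limit along a subsequence would be constant by propagation of
  maxima, a contradiction.\<close>

lemma discounted_oscillation_vanishes:
  fixes v :: "real \<Rightarrow> real^'n \<Rightarrow> real" and \<beta> :: "real^'m \<Rightarrow> real^'n"
  assumes v: "\<And>lam. lam > 0 \<Longrightarrow> visc_sol g q \<beta> a (\<lambda>y r. lam * r - f y) 0 (v lam)"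
    and ua: "uniformly_continuous_on UNIV a" and uf: "uniformly_continuous_on UNIV f"
    and f: "\<And>y. \<bar>f y\<bar> \<le> F"
    and a: "a0 > 0" "\<And>y. a y \<ge> a0"
    and \<beta>: "continuous_on UNIV \<beta>" "\<And>z. norm (\<beta> z) \<le> B * norm z" "B \<ge> 0"
    and q: "sets q = sets borel" "\<And>K. compact K \<Longrightarrow> emeasure q K < \<infinity>"
    and weight: "integrable q (levy_weight g)"
    and condB: "condB q \<beta>" and "\<eta> > 0"
  shows "\<forall>\<^sub>F lam in at_right 0. \<forall>x y. \<bar>lam * v lam x - lam * v lam y\<bar> < \<eta>"
proof (rule ccontr)
  assume not_small: "\<not> ?thesis"
  have "\<exists>lam>0. lam < 1 / (real n + 1) \<and> (\<exists>x y. \<bar>lam * v lam x - lam * v lam y\<bar> \<ge> \<eta>)" for n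
    using not_small unfolding eventually_at_right_field
    by (metis not_le of_nat_0_le_iff add_nonneg_pos zero_less_divide_1_iff zero_less_one)
  then obtain lam where lam: "\<And>n. lam n > 0" "\<And>n. lam n < 1 / (real n + 1)"
    "\<And>n. \<exists>x y. \<bar>lam n * v (lam n) x - lam n * v (lam n) y\<bar> \<ge> \<eta>" by metis
  have lam0: "lam \<longlonglongrightarrow> 0"
  proof (rule tendsto_sandwich[of "\<lambda>_. 0" _ _ "\<lambda>n. 1 / (real n + 1)"])
    show "(\<lambda>n. 1 / (real n + 1)) \<longlonglongrightarrow> 0"
      using LIMSEQ_inverse_real_of_nat by (simp add: inverse_eq_divide add.commute)
  qed (auto intro: always_eventually less_imp_le lam)
  have apos: "\<And>y. a y > 0" using a by (metis less_le_trans)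
  define w where "w n y = lam n * v (lam n) y" for n y
  have sol: "visc_sol g q \<beta> a (\<lambda>y r. lam n * r - f y) 0 (v (lam n))" for n using v lam by blast
  have bd: "\<bar>w n y\<bar> \<le> F" for n y
    unfolding w_def by (rule discounted_bound[OF sol lam(1) apos f])
  have per: "zperiodic (w n)" for n
    using sol[of n] by (simp add: w_def visc_sol_def visc_sub_def zperiodic_def)
  have equi: "\<exists>r>0. \<forall>k s t. dist s t < r \<longrightarrow> \<bar>w k s - w k t\<bar> < e" if "e > 0" for e
  proof -
    obtain r where r: "r > 0" "\<And>lam v s t. lam > 0 \<Longrightarrow> visc_sol g q \<beta> a (\<lambda>y r. lam * r - f y) 0 v \<Longrightarrow>
        dist s t < r \<Longrightarrow> \<bar>lam * v s - lam * v t\<bar> \<le> e / 2"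
      using discounted_equicontinuous[OF ua uf a f, of "e / 2" g q \<beta>] \<open>e > 0\<close> by (metis half_gt_zero)
    have "\<bar>w k s - w k t\<bar> < e" if "dist s t < r" for k s t
      using r(2)[OF lam(1) sol that, of k] \<open>e > 0\<close> by (simp add: w_def)
    with r(1) show ?thesis by blast
  qed
  obtain W \<sigma> where \<sigma>: "strict_mono \<sigma>" and W: "continuous_on UNIV W" "zperiodic W"
    and conv: "\<And>e. e > 0 \<Longrightarrow> \<forall>\<^sub>F k in sequentially. \<forall>y. \<bar>w (\<sigma> k) y - W y\<bar> < e"
    by (rule equicontinuous_zperiodic_subsequence[of w F, OF per bd equi]) (assumption, rule that, blast+)
  have "W (yh + \<beta> z) = W yh" if "\<And>y. W y \<le> W yh" "z \<in> msupport q" for yh z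
  proof (rule limit_maximum_propagates[where v = "\<lambda>k. v (lam (\<sigma> k))" and lam = "lam \<circ> \<sigma>" and F = F
        and f = f and g = g and q = q and a = a and \<beta> = \<beta> and B = B and ?a0.0 = a0 and W = W])
    show "visc_sub g q \<beta> a (\<lambda>y r. (lam \<circ> \<sigma>) k * r - f y) 0 (v (lam (\<sigma> k)))" for k
      using sol[of "\<sigma> k"] by (simp add: visc_sol_def)
    show "continuous_on UNIV (v (lam (\<sigma> k)))" for k
      using sol[of "\<sigma> k"] by (simp add: visc_sol_def)
    show "(lam \<circ> \<sigma>) \<longlonglongrightarrow> 0" by (rule LIMSEQ_subseq_LIMSEQ[OF lam0 \<sigma>])
    show "\<bar>(lam \<circ> \<sigma>) k * v (lam (\<sigma> k)) y\<bar> \<le> F" for k y using bd[of "\<sigma> k" y] by (simp add: w_def)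
    show "\<forall>\<^sub>F k in sequentially. \<forall>y. \<bar>(lam \<circ> \<sigma>) k * v (lam (\<sigma> k)) y - W y\<bar> < e" if "e > 0" for e
      using conv[OF that] by (simp add: w_def)
  qed (use lam(1) f a \<beta> q weight W that in auto)
  then have const: "W x = W y" for x y
    by (rule condB_propagation_imp_constant[OF condB W])
  obtain k where k: "\<forall>y. \<bar>w (\<sigma> k) y - W y\<bar> < \<eta> / 2"
    using eventually_happens[OF conv[of "\<eta> / 2"]] \<open>\<eta> > 0\<close> by auto
  obtain x y where "\<bar>w (\<sigma> k) x - w (\<sigma> k) y\<bar> \<ge> \<eta>" using lam(3)[of "\<sigma> k"] by (auto simp: w_def)
  moreover have "\<bar>w (\<sigma> k) x - W x\<bar> < \<eta> / 2" "\<bar>w (\<sigma> k) y - W y\<bar> < \<eta> / 2" using k by auto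
  ultimately show False using const[of x y] by linarith
qed

text \<open>Test functions and nonlocal term are the same in both inequalities; replacing
  \<open>lam * v\<close> by \<open>d\<close> costs at most \<open>\<delta>\<close>.\<close>

lemma discounted_imp_ergodic_sub:
  assumes "visc_sub g q \<beta> a (\<lambda>y r. lam * r - f y) 0 v" "\<And>y. d - lam * v y \<le> \<delta>"
  shows "visc_sub g q \<beta> a (\<lambda>y r. d - f y) \<delta> v"
  unfolding visc_sub_def
proof (intro conjI allI impI)
  show "usc v" "zperiodic v" using assms(1) by (auto simp: visc_sub_def)
  fix yh phi Dphi
  assume touch: "C2_grad phi Dphi \<and> (\<forall>y. v y - phi y \<le> v yh - phi yh) \<and> v yh = phi yh"
  from assms(1) touch have 1: "integrable q (nl_integrand g \<beta> v (Dphi yh) yh)"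
    "lam * v yh - f yh - a yh * (\<integral>z. nl_integrand g \<beta> v (Dphi yh) yh z \<partial>q) \<le> 0"
    unfolding visc_sub_def by blast+
  then show "integrable q (nl_integrand g \<beta> v (Dphi yh) yh)"
    "d - f yh - a yh * (\<integral>z. nl_integrand g \<beta> v (Dphi yh) yh z \<partial>q) \<le> \<delta>"
    using assms(2)[of yh] by linarith+
qed

lemma discounted_imp_ergodic_super:
  assumes "visc_super g q \<beta> a (\<lambda>y r. lam * r - f y) 0 v" "\<And>y. lam * v y - d \<le> \<delta>"
  shows "visc_super g q \<beta> a (\<lambda>y r. d - f y) (- \<delta>) v"
  unfolding visc_super_def
proof (intro conjI allI impI)
  show "lsc v" "zperiodic v" using assms(1) by (auto simp: visc_super_def)
  fix yh phi Dphi
  assume touch: "C2_grad phi Dphi \<and> (\<forall>y. v y - phi y \<ge> v yh - phi yh) \<and> v yh = phi yh"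
  from assms(1) touch have 1: "integrable q (nl_integrand g \<beta> v (Dphi yh) yh)"
    "lam * v yh - f yh - a yh * (\<integral>z. nl_integrand g \<beta> v (Dphi yh) yh z \<partial>q) \<ge> 0"
    unfolding visc_super_def by blast+
  then show "integrable q (nl_integrand g \<beta> v (Dphi yh) yh)"
    "d - f yh - a yh * (\<integral>z. nl_integrand g \<beta> v (Dphi yh) yh z \<partial>q) \<ge> - \<delta>"
    using assms(2)[of yh] by linarith+
qed

theorem theorem3p1:
  fixes with_grad :: bool
    and \<beta> :: "real^'m \<Rightarrow> real^'n"
    and a f0 :: "real^'n \<Rightarrow> real"
    and q0 :: "(real^'m) measure"
    and B1 a0 L1 L2 \<theta>1 \<theta>2 :: real
    and v :: "real \<Rightarrow> real^'n \<Rightarrow> real"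
  assumes dims: "CARD('m) \<le> CARD('n)"
    and beta_cont: "continuous_on UNIV \<beta>"
    and beta_hom: "\<forall>c>0. \<forall>z. \<beta> (c *\<^sub>R z) = c *\<^sub>R \<beta> z"
    and beta_bd: "\<forall>z. norm (\<beta> z) \<le> B1 * norm z"
    and a_cont: "continuous_on UNIV a"
    and a_per: "zperiodic a"
    and a0: "a0 > 0" "\<forall>y. a y \<ge> a0"
    and a_hoelder: "0 < \<theta>1" "\<theta>1 \<le> 1" "\<forall>y y'. \<bar>a y - a y'\<bar> \<le> L1 * dist y y' powr \<theta>1"
    and q0_sets: "sets q0 = sets borel"
    and q0_radon: "\<forall>K. compact K \<longrightarrow> emeasure q0 K < \<infinity>"
    and q0_B: "condB q0 \<beta>"
    and q0_moment: "(\<integral>\<^sup>+ z. ennreal (indicator {z. norm z < 1} z * norm z ^ (if with_grad then 2 else 1)) \<partial>q0)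
        + (\<integral>\<^sup>+ z. ennreal (indicator {z. norm z \<ge> 1} z * norm z ^ (if with_grad then 1 else 0)) \<partial>q0) < \<infinity>"
    and f0_per: "zperiodic f0"
    and f0_hoelder: "L2 > 0" "0 < \<theta>2" "\<theta>2 \<le> 1" "\<forall>y y'. \<bar>f0 y - f0 y'\<bar> \<le> L2 * dist y y' powr \<theta>2"
    and v_sol: "\<forall>lam>0. visc_sol with_grad q0 \<beta> a (\<lambda>y r. lam * r - f0 y) 0 (v lam)"
  shows "\<exists>d. uniform_limit torus_cube (\<lambda>lam y. lam * v lam y) (\<lambda>y. d) (at_right 0)
           \<and> (\<forall>\<delta>>0. (\<exists>u. visc_sub with_grad q0 \<beta> a (\<lambda>y r. d - f0 y) \<delta> u)
                   \<and> (\<exists>u. visc_super with_grad q0 \<beta> a (\<lambda>y r. d - f0 y) (- \<delta>) u))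
           \<and> (\<forall>d'. (\<forall>\<delta>>0. (\<exists>u. visc_sub with_grad q0 \<beta> a (\<lambda>y r. d' - f0 y) \<delta> u)
                   \<and> (\<exists>u. visc_super with_grad q0 \<beta> a (\<lambda>y r. d' - f0 y) (- \<delta>) u)) \<longrightarrow> d' = d)"
proof -
  have ua: "uniformly_continuous_on UNIV a" and uf: "uniformly_continuous_on UNIV f0"
    using hoelder_imp_uniformly_continuous a_hoelder f0_hoelder by blast+
  obtain F where F: "\<And>y. \<bar>f0 y\<bar> \<le> F"
    using continuous_zperiodic_bounded[OF uniformly_continuous_imp_continuous[OF uf] f0_per] by blast
  have a: "\<And>y. a y \<ge> a0" using a0(2) by blast
  \<comment> \<open>The propagation of maxima takes a nonnegative growth constant, hence the
    absolute value.\<close>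
  have \<beta>: "norm (\<beta> z) \<le> \<bar>B1\<bar> * norm z" for z
    using beta_bd[rule_format, of z] by (meson abs_ge_self mult_right_mono norm_ge_zero order_trans)
  have weight: "integrable q0 (levy_weight with_grad)"
    by (rule integrable_levy_weight[OF q0_sets q0_moment])
  have sol: "\<And>lam. lam > 0 \<Longrightarrow> visc_sol with_grad q0 \<beta> a (\<lambda>y r. lam * r - f0 y) 0 (v lam)"
    using v_sol by blast
  have osc: "\<forall>\<^sub>F lam in at_right 0. \<forall>x y. \<bar>lam * v lam x - lam * v lam y\<bar> < \<eta>" if "\<eta> > 0" for \<eta>
    using q0_radon that
    by (intro discounted_oscillation_vanishes[OF sol ua uf F a0(1) a beta_cont \<beta> _ q0_sets _ weight q0_B]) auto
  have compare: "d1 \<le> d2 + \<delta>1 + \<delta>2"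
    if "visc_sub with_grad q0 \<beta> a (\<lambda>y r. d1 - f0 y) \<delta>1 u"
      "visc_super with_grad q0 \<beta> a (\<lambda>y r. d2 - f0 y) (- \<delta>2) w" for d1 d2 \<delta>1 \<delta>2 u w
    by (rule ergodic_constant_comparison[OF ua uf a0(1) a F that])
  have corrector: "visc_sub with_grad q0 \<beta> a (\<lambda>y r. d - f0 y) \<delta> (v lam)"
    "visc_super with_grad q0 \<beta> a (\<lambda>y r. d - f0 y) (- \<delta>) (v lam)"
    if "lam > 0" "\<And>y. \<bar>lam * v lam y - d\<bar> \<le> \<delta>" for d \<delta> lam
  proof -
    have "d - lam * v lam y \<le> \<delta>" "lam * v lam y - d \<le> \<delta>" for y using that(2)[of y] by linarith+
    then show "visc_sub with_grad q0 \<beta> a (\<lambda>y r. d - f0 y) \<delta> (v lam)"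
      "visc_super with_grad q0 \<beta> a (\<lambda>y r. d - f0 y) (- \<delta>) (v lam)"
      using sol[OF that(1)] discounted_imp_ergodic_sub[of with_grad q0 \<beta> a lam f0 "v lam" d \<delta>]
        discounted_imp_ergodic_super[of with_grad q0 \<beta> a lam f0 "v lam" d \<delta>]
      by (auto simp: visc_sol_def)
  qed
  \<comment> \<open>Each of \<open>v lam\<close> and \<open>v mu\<close> is an approximate
    corrector, with error \<open>\<eta>\<close>, for its own scaled value at 0. Comparing the
    subsolution of one with the supersolution of the other, both ways, bounds the
    difference.\<close>
  have close: "\<bar>lam * v lam 0 - mu * v mu 0\<bar> \<le> 2 * \<eta>"
    if "lam > 0" "mu > 0" "\<forall>x y. \<bar>lam * v lam x - lam * v lam y\<bar> < \<eta>"
      "\<forall>x y. \<bar>mu * v mu x - mu * v mu y\<bar> < \<eta>" for lam mu \<eta>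
  proof -
    note lam = corrector[OF that(1) less_imp_le[OF that(3)[rule_format, of _ 0]]]
    note mu = corrector[OF that(2) less_imp_le[OF that(4)[rule_format, of _ 0]]]
    from compare[OF lam(1) mu(2)] compare[OF mu(1) lam(2)] show ?thesis by linarith
  qed
  \<comment> \<open>The candidate for \<open>d\<close> is obtained along the discounts
    \<open>1 / (n + 1)\<close>; \<open>close\<close> later transfers the limit to all small
    discounts.\<close>
  define c where "c n = inverse (real (Suc n)) * v (inverse (real (Suc n))) 0" for n
  have seq: "filterlim (\<lambda>n. inverse (real (Suc n))) (at_right 0) sequentially"
    unfolding filterlim_at using LIMSEQ_inverse_real_of_nat by simp
  have "Cauchy c"
  proof (rule metric_CauchyI)
    fix e :: real assume "e > 0"
    then obtain N where N: "\<forall>n\<ge>N. \<forall>x y. \<bar>inverse (real (Suc n)) * v (inverse (real (Suc n))) x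
        - inverse (real (Suc n)) * v (inverse (real (Suc n))) y\<bar> < e / 3"
      using eventually_compose_filterlim[OF osc[of "e / 3"] seq] unfolding eventually_sequentially by auto
    have "dist (c i) (c j) < e" if "i \<ge> N" "j \<ge> N" for i j
      using close[OF _ _ N[rule_format, OF that(1), THEN allI, THEN allI] N[rule_format, OF that(2), THEN allI, THEN allI]]
        \<open>e > 0\<close> by (simp add: c_def dist_real_def)
    then show "\<exists>N. \<forall>i\<ge>N. \<forall>j\<ge>N. dist (c i) (c j) < e" by blast
  qed
  then obtain d where d: "c \<longlonglongrightarrow> d" using Cauchy_convergent convergent_def by blast
  \<comment> \<open>The value at 0 is within \<open>2 * (e / 5)\<close> of \<open>d\<close>, and the
    oscillation adds less than \<open>e / 5\<close>.\<close>
  have lim: "\<forall>\<^sub>F lam in at_right 0. \<forall>y. \<bar>lam * v lam y - d\<bar> < e" if "e > 0" for e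
  proof -
    have e5: "e / 5 > 0" using that by simp
    have "\<forall>\<^sub>F lam in at_right 0. lam > (0::real)" by (rule eventually_at_right_less)
    with osc[OF e5] show ?thesis
    proof eventually_elim
      case (elim lam)
      have "\<forall>\<^sub>F n in sequentially. \<bar>lam * v lam 0 - c n\<bar> \<le> 2 * (e / 5)"
        using eventually_compose_filterlim[OF osc[OF e5] seq]
      proof eventually_elim
        case inner: (elim n)
        show ?case unfolding c_def by (rule close[OF elim(2) _ elim(1) inner]) simp
      qed
      then have "\<bar>lam * v lam 0 - d\<bar> \<le> 2 * (e / 5)"
        by (intro tendsto_upperbound[OF tendsto_rabs[OF tendsto_diff[OF tendsto_const d]]]) auto
      then have "\<bar>lam * v lam y - d\<bar> < e" for y
        using elim(1)[rule_format, of y 0] that by linarith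
      then show ?case by blast
    qed
  qed
  have correctors: "(\<exists>u. visc_sub with_grad q0 \<beta> a (\<lambda>y r. d - f0 y) \<delta> u)
      \<and> (\<exists>u. visc_super with_grad q0 \<beta> a (\<lambda>y r. d - f0 y) (- \<delta>) u)" if pos: "\<delta> > 0" for \<delta>
  proof -
    obtain lam where "lam > 0" "\<forall>y. \<bar>lam * v lam y - d\<bar> < \<delta>"
      using eventually_happens[OF eventually_conj[OF eventually_at_right_less lim[OF pos]]]
      by (auto simp: trivial_limit_at_right_real)
    then show ?thesis using corrector[of lam d \<delta>] less_imp_le by blast
  qed
  \<comment> \<open>The subsolution for either constant is compared with the supersolution for the
    other, each with error \<open>\<epsilon> / 2\<close>.\<close>
  have unique: "d' = d" if primed: "\<forall>\<delta>>0. (\<exists>u. visc_sub with_grad q0 \<beta> a (\<lambda>y r. d' - f0 y) \<delta> u)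
      \<and> (\<exists>u. visc_super with_grad q0 \<beta> a (\<lambda>y r. d' - f0 y) (- \<delta>) u)" for d'
  proof -
    have "\<bar>d' - d\<bar> \<le> \<epsilon>" if "\<epsilon> > 0" for \<epsilon>
    proof -
      have h: "\<epsilon> / 2 > 0" using that by simp
      obtain u w where 1: "visc_sub with_grad q0 \<beta> a (\<lambda>y r. d - f0 y) (\<epsilon>/2) u"
        "visc_super with_grad q0 \<beta> a (\<lambda>y r. d - f0 y) (- (\<epsilon>/2)) w" using correctors[OF h] by blast
      obtain u' w' where 2: "visc_sub with_grad q0 \<beta> a (\<lambda>y r. d' - f0 y) (\<epsilon>/2) u'"
        "visc_super with_grad q0 \<beta> a (\<lambda>y r. d' - f0 y) (- (\<epsilon>/2)) w'"
        using h primed by meson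
      from compare[OF 1(1) 2(2)] compare[OF 2(1) 1(2)] show ?thesis by linarith
    qed
    then have "\<bar>d' - d\<bar> \<le> 0" by (rule field_le_epsilon[of _ 0, simplified])
    then show ?thesis by simp
  qed
  have "uniform_limit torus_cube (\<lambda>lam y. lam * v lam y) (\<lambda>y. d) (at_right 0)"
    unfolding uniform_limit_iff dist_real_def
    by (intro allI impI eventually_mono[OF lim]) auto
  with correctors unique show ?thesis by blast
qed

end
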